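(* For $f,h\in C^\infty(\mathfrak M)_{\mathrm{red}}$, the second reduced Poisson bracket is given, with all derivatives at $(e^q,J)$, by $$2\{f,h\}_2^{\mathrm{red}}(e^q,J)=\langle\nabla_1f,(\nabla_2h+\nabla_2'h)^-_0\rangle-\langle\nabla_1h,(\nabla_2f+\nabla_2'f)^-_0\rangle+\langle R(q)[d_2f,J]^+,(\nabla_2h+\nabla_2'h)^-\rangle-\langle R(q)[d_2h,J]^+,(\nabla_2f+\nabla_2'f)^-\rangle$$ $$\qquad+\langle(\nabla_2f)^-,(\nabla_2'h)^-\rangle+\langle(\nabla_2'f)^+,(\nabla_2h)^+\rangle-\langle(\nabla_2'f)^-,(\nabla_2h)^-\rangle-\langle(\nabla_2f)^+,(\nabla_2'h)^+\rangle .$$ If $h$ is the restriction $H\circ\iota$ of any of the functions $H_k(g,J)=\frac1k\Re\operatorname{tr}(J^k)$ or $\tilde H_k(g,J)=\frac1k\Im\operatorname{tr}(J^k)$ ($k\ge1$), this can be written as $$\{f,h\}_2^{\mathrm{red}}(e^q,J)=\langle\nabla_1f,(\nabla_2h)^-_0\rangle+\langle d_2f,[R(q)(\nabla_2h)^--(\nabla_2h)^+,J]\rangle .$$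
   Context: $G=\mathrm{GL}(n,\mathbb C)$ (real Lie group), $\mathcal G=\mathfrak{gl}(n,\mathbb C)$ (real Lie algebra) with $\langle X,Y\rangle=\Re\operatorname{tr}(XY)$; $X=X_>+X_0+X_<$ (strictly upper, diagonal, strictly lower parts), $r(X)=\frac12(X_>-X_<)$, $r_\pm=r\pm\frac12\mathrm{id}$. $\mathcal G^+=\mathfrak u(n)$ (anti-Hermitian), $\mathcal G^-=\mathrm i\,\mathfrak u(n)$ (Hermitian); $X=X^++X^-$ with $X^\pm=\frac12(X\mp X^* )$; $\mathcal G^\pm_0$ are the diagonal matrices in $\mathcal G^\pm$ and $X^-_0$ is the diagonal part of $X^-$. $\mathfrak M=G\times\mathcal G=\{(g,J)\}$. For $F\in C^\infty(\mathfrak M,\mathbb R)$: $\langle\nabla_1F,X\rangle=\frac{d}{dt}|_0F(e^{tX}g,J)$, $\langle\nabla_1'F,X\rangle=\frac{d}{dt}|_0F(ge^{tX},J)$, $\langle d_2F,X\rangle=\frac{d}{dt}|_0F(g,J+tX)$ for $X\in\mathcal G$, $\nabla_2F=J\,d_2F$, $\nabla_2'F=(d_2F)J$. The second Poisson bracket on $\mathfrak M$ is $\{F,H\}_2=\langle r\nabla_1F,\nabla_1H\rangle-\langle r\nabla_1'F,\nabla_1'H\rangle+\langle \nabla_2F-\nabla_2'F, r_+\nabla_2'H-r_-\nabla_2H\rangle+\langle\nabla_1F, r_+\nabla_2'H-r_-\nabla_2H\rangle-\langle\nabla_1H, r_+\nabla_2'F-r_-\nabla_2F\rangle$. For $\eta\in\mathrm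 U(n)$, $\mathcal R_\eta(g,J)=(g\eta^{-1},J)$, $\mathcal L_\eta(g,J)=(\eta g,\eta J\eta^{-1})$; $C^\infty(\mathfrak M)^{\mathrm U(n)\times\mathrm U(n)}$ is the set of smooth real functions invariant under all these maps (it is closed under $\{\ ,\ \}_2$). Let $\mathfrak M_0^{\mathrm{reg}}=\{(e^q,J): J\in\mathcal G,\ q=\mathrm{diag}(q_1,\dots,q_n)\in\mathcal G_0^-,\ q_1>\dots>q_n\}$ with inclusion $\iota$, and $C^\infty(\mathfrak M)_{\mathrm{red}}=\{F\circ\iota: F\in C^\infty(\mathfrak M)^{\mathrm U(n)\times\mathrm U(n)}\}$; $\{F\circ\iota,H\circ\iota\}_2^{\mathrm{red}}=\{F,H\}_2\circ\iota$. For $f\in C^\infty(\mathfrak M_0^{\mathrm{reg}})$: $\nabla_1f\in\mathcal G^-_0$ with $\langle\nabla_1f,X_0\rangle=\frac{d}{dt}|_0f(e^{q+tX_0},J)$ ($X_0\in\mathcal G_0^-$), $d_2f\in\mathcal G$ with $\langle d_2f,X\rangle=\frac{d}{dt}|_0f(e^q,J+tX)$, $\nabla_2f=J\,d_2f$, $\nabla_2'f=(d_2f)J$. $R(q)\in\mathrm{End}(\mathcal G)$: $(R(q)X)_{ii}=0$, $(R(q)X)_{ij}=X_{ij}\coth(q_i-q_j)$ for $i\ne j$. *)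

theory Defs
  imports "HOL-Analysis.Analysis"
begin

text \<open>n x n complex matrices, indexed by a finite linearly ordered type 'n
  (the order on 'n plays the role of the order 1 < 2 < ... < n of indices).\<close>
type_synonym 'n cmat = "complex^'n^'n"

coinductive Cinf_on :: "'a::real_normed_vector set \<Rightarrow> ('a \<Rightarrow> real) \<Rightarrow> bool"
  for S :: "'a set" where
  "f differentiable_on S \<Longrightarrow> (\<And>v. Cinf_on S (\<lambda>x. frechet_derivative f (at x) v))
    \<Longrightarrow> Cinf_on S f"

definition ip :: "'n::finite cmat \<Rightarrow> 'n cmat \<Rightarrow> real" where
  "ip X Y = Re (trace (X ** Y))"

definition mstar :: "'n::finite cmat \<Rightarrow> 'n cmat" where
  "mstar X = (\<chi> i j. cnj (X $ j $ i))"

fun mpow :: "'n::finite cmat \<Rightarrow> nat \<Rightarrow> 'n cmat" where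
  "mpow X 0 = mat 1"
| "mpow X (Suc k) = X ** mpow X k"

definition mexp :: "'n::finite cmat \<Rightarrow> 'n cmat" where
  "mexp X = (\<Sum>k. (1 / fact k) *\<^sub>R mpow X k)"

definition comm :: "'n::finite cmat \<Rightarrow> 'n cmat \<Rightarrow> 'n cmat" where
  "comm X Y = X ** Y - Y ** X"

definition pplus :: "'n::finite cmat \<Rightarrow> 'n cmat" where
  "pplus X = (1/2) *\<^sub>R (X - mstar X)"

definition pminus :: "'n::finite cmat \<Rightarrow> 'n cmat" where
  "pminus X = (1/2) *\<^sub>R (X + mstar X)"

definition upper :: "'n::{finite,linorder} cmat \<Rightarrow> 'n cmat" where
  "upper X = (\<chi> i j. if i < j then X $ i $ j else 0)"

definition dpart :: "'n::finite cmat \<Rightarrow> 'n cmat" where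
  "dpart X = (\<chi> i j. if i = j then X $ i $ j else 0)"

definition lower :: "'n::{finite,linorder} cmat \<Rightarrow> 'n cmat" where
  "lower X = (\<chi> i j. if j < i then X $ i $ j else 0)"

definition pminus0 :: "'n::finite cmat \<Rightarrow> 'n cmat" where
  "pminus0 X = dpart (pminus X)"

definition rmat :: "'n::{finite,linorder} cmat \<Rightarrow> 'n cmat" where
  "rmat X = (1/2) *\<^sub>R (upper X - lower X)"

definition rplus :: "'n::{finite,linorder} cmat \<Rightarrow> 'n cmat" where
  "rplus X = rmat X + (1/2) *\<^sub>R X"

definition rminus :: "'n::{finite,linorder} cmat \<Rightarrow> 'n cmat" where
  "rminus X = rmat X - (1/2) *\<^sub>R X"

definition coth :: "real \<Rightarrow> real" where
  "coth x = cosh x / sinh x"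

text \<open>R(q); q = diag(q_1,...,q_n) is given as a (real) diagonal matrix, q_i = Re (q$i$i)\<close>
definition Rq :: "'n::finite cmat \<Rightarrow> 'n cmat \<Rightarrow> 'n cmat" where
  "Rq q X = (\<chi> i j. if i = j then 0
               else X $ i $ j * complex_of_real (coth (Re (q $ i $ i) - Re (q $ j $ j))))"

definition unitary :: "'n::finite cmat set" where
  "unitary = {U. U ** mstar U = mat 1 \<and> mstar U ** U = mat 1}"

definition G0minus :: "'n::finite cmat set" where
  "G0minus = {X. mstar X = X \<and> dpart X = X}"

definition Mfld :: "('n::finite cmat \<times> 'n cmat) set" where
  "Mfld = {p. invertible (fst p)}"

definition regular :: "'n::{finite,linorder} cmat \<Rightarrow> bool" where
  "regular q \<longleftrightarrow> q \<in> G0minus \<and> (\<forall>i j. i < j \<longrightarrow> Re (q $ j $ j) < Re (q $ i $ i))"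

definition M0reg :: "('n::{finite,linorder} cmat \<times> 'n cmat) set" where
  "M0reg = {(mexp q, J) | q J. regular q}"

definition grad_in :: "'n::finite cmat set \<Rightarrow> ('n cmat \<Rightarrow> real) \<Rightarrow> 'n cmat" where
  "grad_in S L = (THE Y. Y \<in> S \<and> (\<forall>X\<in>S. ip Y X = L X))"

definition nabla1 :: "('n::finite cmat \<times> 'n cmat \<Rightarrow> real) \<Rightarrow> 'n cmat \<Rightarrow> 'n cmat \<Rightarrow> 'n cmat" where
  "nabla1 F g J = grad_in UNIV (\<lambda>X. deriv (\<lambda>t. F (mexp (t *\<^sub>R X) ** g, J)) 0)"

definition nabla1' :: "('n::finite cmat \<times> 'n cmat \<Rightarrow> real) \<Rightarrow> 'n cmat \<Rightarrow> 'n cmat \<Rightarrow> 'n cmat" where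
  "nabla1' F g J = grad_in UNIV (\<lambda>X. deriv (\<lambda>t. F (g ** mexp (t *\<^sub>R X), J)) 0)"

definition d2 :: "('n::finite cmat \<times> 'n cmat \<Rightarrow> real) \<Rightarrow> 'n cmat \<Rightarrow> 'n cmat \<Rightarrow> 'n cmat" where
  "d2 F g J = grad_in UNIV (\<lambda>X. deriv (\<lambda>t. F (g, J + t *\<^sub>R X)) 0)"

definition nabla2 :: "('n::finite cmat \<times> 'n cmat \<Rightarrow> real) \<Rightarrow> 'n cmat \<Rightarrow> 'n cmat \<Rightarrow> 'n cmat" where
  "nabla2 F g J = J ** d2 F g J"

definition nabla2' :: "('n::finite cmat \<times> 'n cmat \<Rightarrow> real) \<Rightarrow> 'n cmat \<Rightarrow> 'n cmat \<Rightarrow> 'n cmat" where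
  "nabla2' F g J = d2 F g J ** J"

definition bracket2 :: "('n::{finite,linorder} cmat \<times> 'n cmat \<Rightarrow> real)
    \<Rightarrow> ('n cmat \<times> 'n cmat \<Rightarrow> real) \<Rightarrow> 'n cmat \<Rightarrow> 'n cmat \<Rightarrow> real" where
  "bracket2 F H g J =
     ip (rmat (nabla1 F g J)) (nabla1 H g J) - ip (rmat (nabla1' F g J)) (nabla1' H g J)
   + ip (nabla2 F g J - nabla2' F g J) (rplus (nabla2' H g J) - rminus (nabla2 H g J))
   + ip (nabla1 F g J) (rplus (nabla2' H g J) - rminus (nabla2 H g J))
   - ip (nabla1 H g J) (rplus (nabla2' F g J) - rminus (nabla2 F g J))"

definition invariant_smooth :: "('n::finite cmat \<times> 'n cmat \<Rightarrow> real) \<Rightarrow> bool" where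
  "invariant_smooth F \<longleftrightarrow> Cinf_on Mfld F \<and>
     (\<forall>\<eta>\<in>unitary. \<forall>g J. invertible g \<longrightarrow>
        F (g ** matrix_inv \<eta>, J) = F (g, J) \<and>
        F (\<eta> ** g, \<eta> ** J ** matrix_inv \<eta>) = F (g, J))"

definition red_nabla1 :: "('n::finite cmat \<times> 'n cmat \<Rightarrow> real) \<Rightarrow> 'n cmat \<Rightarrow> 'n cmat \<Rightarrow> 'n cmat" where
  "red_nabla1 f q J = grad_in G0minus (\<lambda>X0. deriv (\<lambda>t. f (mexp (q + t *\<^sub>R X0), J)) 0)"

definition red_d2 :: "('n::finite cmat \<times> 'n cmat \<Rightarrow> real) \<Rightarrow> 'n cmat \<Rightarrow> 'n cmat \<Rightarrow> 'n cmat" where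
  "red_d2 f q J = grad_in UNIV (\<lambda>X. deriv (\<lambda>t. f (mexp q, J + t *\<^sub>R X)) 0)"

definition red_nabla2 :: "('n::finite cmat \<times> 'n cmat \<Rightarrow> real) \<Rightarrow> 'n cmat \<Rightarrow> 'n cmat \<Rightarrow> 'n cmat" where
  "red_nabla2 f q J = J ** red_d2 f q J"

definition red_nabla2' :: "('n::finite cmat \<times> 'n cmat \<Rightarrow> real) \<Rightarrow> 'n cmat \<Rightarrow> 'n cmat \<Rightarrow> 'n cmat" where
  "red_nabla2' f q J = red_d2 f q J ** J"

definition Hk :: "nat \<Rightarrow> 'n::finite cmat \<times> 'n cmat \<Rightarrow> real" where
  "Hk k p = (1 / real k) * Re (trace (mpow (snd p) k))"

definition Hk_tilde :: "nat \<Rightarrow> 'n::finite cmat \<times> 'n cmat \<Rightarrow> real" where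
  "Hk_tilde k p = (1 / real k) * Im (trace (mpow (snd p) k))"

end

theory Submission
  imports Defs
begin

text \<open>
  Write \<open>N = \<nabla>\<^sub>1F\<close> and \<open>C = [d\<^sub>2F, J]\<close> at \<open>(e\<^sup>q, J)\<close>. Right invariance makes
  \<open>\<nabla>\<^sub>1'F = e\<^bsup>-q\<^esup> N e\<^bsup>q\<^esup>\<close> Hermitian, left invariance gives \<open>N\<^sup>+ = C\<^sup>+\<close>; comparing entries,
  \<open>N = C\<^sup>+ + R(q) C\<^sup>+ + \<nabla>\<^sub>1f\<close>. Conjugation by a diagonal matrix commutes with \<open>r\<close>, so the two
  terms \<open>\<langle>r\<nabla>\<^sub>1F, \<nabla>\<^sub>1H\<rangle>\<close> and \<open>\<langle>r\<nabla>\<^sub>1'F, \<nabla>\<^sub>1'H\<rangle>\<close> cancel. In the remaining terms the contributions of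
  \<open>r\<close> cancel too, because \<open>r\<close> is antisymmetric, exchanges Hermitian and anti-Hermitian matrices,
  and commutes with the antisymmetric \<open>R(q)\<close>.
\<close>

section \<open>The trace pairing, the adjoint and the Hermitian splitting\<close>

lemma matrix_mult_component: "(A ** B) $ i $ j = (\<Sum>k\<in>UNIV. A $ i $ k * B $ k $ j)"
  by (simp add: matrix_matrix_mult_def)

lemma ip_altdef: "ip X Y = (\<Sum>i\<in>UNIV. \<Sum>j\<in>UNIV. Re (X $ i $ j * Y $ j $ i))"
  by (simp add: ip_def trace_def matrix_mult_component Re_sum)

lemma ip_commute: "ip X Y = ip Y X"
  unfolding ip_def by (subst trace_mul_sym) (rule refl)

lemma bilinear_ip: "bilinear ip"
  unfolding bilinear_def
  by (auto intro!: linearI simp: ip_altdef sum.distrib sum_subtractf sum_distrib_left algebra_simps)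

lemmas ip_add_left = bilinear_ladd [OF bilinear_ip]
  and ip_add_right = bilinear_radd [OF bilinear_ip]
  and ip_diff_left = bilinear_lsub [OF bilinear_ip]
  and ip_diff_right = bilinear_rsub [OF bilinear_ip]
  and ip_minus_left = bilinear_lneg [OF bilinear_ip]
  and ip_minus_right = bilinear_rneg [OF bilinear_ip]
  and ip_scaleR_left = bilinear_lmul [OF bilinear_ip]
  and ip_scaleR_right = bilinear_rmul [OF bilinear_ip]
  and ip_zero_left = bilinear_lzero [OF bilinear_ip]
  and ip_zero_right = bilinear_rzero [OF bilinear_ip]

lemmas ip_simps = ip_add_left ip_add_right ip_diff_left ip_diff_right ip_minus_left ip_minus_right
  ip_scaleR_left ip_scaleR_right ip_zero_left ip_zero_right

lemma ip_mult_left: "ip (A ** B) C = ip A (B ** C)"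
  by (simp add: ip_def matrix_mul_assoc)

lemma ip_mult_cyclic: "ip (A ** B) C = ip B (C ** A)"
  by (metis ip_commute ip_mult_left)

lemma ip_comm_right: "ip A (comm X B) = - ip (comm A B) X"
  by (simp add: comm_def ip_simps ip_mult_left [of A B X] ip_mult_cyclic [of B A X])

lemma mstar_component [simp]: "mstar X $ i $ j = cnj (X $ j $ i)"
  by (simp add: mstar_def)

lemma mstar_mstar [simp]: "mstar (mstar X) = X"
  by (simp add: vec_eq_iff)

lemma mstar_add: "mstar (X + Y) = mstar X + mstar Y"
  and mstar_diff: "mstar (X - Y) = mstar X - mstar Y"
  and mstar_minus: "mstar (- X) = - mstar X"
  and mstar_scaleR: "mstar (c *\<^sub>R X) = c *\<^sub>R mstar X"
  by (simp_all add: vec_eq_iff)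

lemma mstar_mat_1 [simp]: "mstar (mat 1) = mat 1"
  by (simp add: vec_eq_iff mat_def)

lemma mstar_mult: "mstar (X ** Y) = mstar Y ** mstar X"
  by (simp add: vec_eq_iff matrix_mult_component mult.commute)

lemma ip_mstar_mstar: "ip (mstar X) (mstar Y) = ip X Y"
  by (simp add: ip_def trace_def matrix_mult_component Re_sum)
    (subst sum.swap, simp)

text \<open>The trace form is indefinite; this ties it to the positive definite Euclidean inner
  product, from which nondegeneracy and the existence of gradients follow.\<close>

lemma ip_mstar_left: "ip (mstar X) Y = X \<bullet> Y"
  by (simp add: ip_altdef inner_vec_def inner_complex_def)
    (subst sum.swap, simp)

lemma ip_eqI: "A = B" if "\<And>X. ip A X = ip B X"
proof -
  \<comment> \<open>Testing against the adjoint of the difference turns the pairing into a squared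
    Euclidean norm.\<close>
  have "mstar (A - B) \<bullet> mstar (A - B) = 0"
    using that [of "mstar (A - B)"] by (simp flip: ip_mstar_left add: ip_simps)
  then show ?thesis
    by (metis eq_iff_diff_eq_0 inner_eq_zero_iff mstar_diff mstar_mstar)
qed

text \<open>Taking the adjoint of both arguments preserves the pairing but here also flips its
  sign.\<close>

lemma ip_hermitian_antihermitian:
  assumes "mstar X = X" "mstar Y = - Y"
  shows "ip X Y = 0"
  using ip_mstar_mstar [of X Y] by (simp add: assms ip_simps)

lemma mstar_pplus: "mstar (pplus X) = - pplus X"
  and mstar_pminus: "mstar (pminus X) = pminus X"
  by (simp_all add: pplus_def pminus_def mstar_scaleR mstar_diff mstar_add algebra_simps)

lemma pplus_plus_pminus: "pplus X + pminus X = X"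
  by (simp add: pplus_def pminus_def vec_eq_iff complex_eq_iff field_simps)

lemma pplus_add: "pplus (X + Y) = pplus X + pplus Y"
  and pplus_diff: "pplus (X - Y) = pplus X - pplus Y"
  and pminus_add: "pminus (X + Y) = pminus X + pminus Y"
  and pminus_diff: "pminus (X - Y) = pminus X - pminus Y"
  by (simp_all add: pplus_def pminus_def mstar_add mstar_diff algebra_simps)

lemma pplus_eq_0_iff: "pplus X = 0 \<longleftrightarrow> mstar X = X"
  by (auto simp: pplus_def)

lemma ip_pplus_left: "ip (pplus X) Y = ip (pplus X) (pplus Y)"
  and ip_pminus_left: "ip (pminus X) Y = ip (pminus X) (pminus Y)"
proof -
  have orth: "ip (pminus A) (pplus B) = 0" "ip (pplus B) (pminus A) = 0" for A B :: "'a cmat"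
    by (simp_all add: ip_hermitian_antihermitian mstar_pplus mstar_pminus ip_commute [of "pplus B"])
  have "ip A Y = ip A (pplus Y) + ip A (pminus Y)" for A
    by (simp add: pplus_plus_pminus flip: ip_add_right)
  then show "ip (pplus X) Y = ip (pplus X) (pplus Y)"
    and "ip (pminus X) Y = ip (pminus X) (pminus Y)"
    by (metis orth add.left_neutral add.right_neutral)+
qed

lemma ip_pplus_pminus: "ip X Y = ip (pplus X) (pplus Y) + ip (pminus X) (pminus Y)"
  by (metis ip_add_left ip_pminus_left ip_pplus_left pplus_plus_pminus)

text \<open>Differentiating invariance under U(n) only yields pairings with anti-Hermitian matrices,
  its Lie algebra; such pairings see exactly the anti-Hermitian part.\<close>

lemma pplus_eqI:
  assumes "\<And>X. mstar X = - X \<Longrightarrow> ip A X = ip B X"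
  shows "pplus A = pplus B"
proof (rule ip_eqI)
  show "ip (pplus A) X = ip (pplus B) X" for X
    using assms [of "pplus X"]
    by (simp add: mstar_pplus) (metis ip_commute ip_pplus_left)
qed

subsection \<open>Entrywise multipliers\<close>

text \<open>The operators \<open>r\<close> and \<open>R(q)\<close>, the diagonal part and conjugation by \<open>e\<^sup>q\<close> are all of this form.\<close>
definition hmul :: "('n \<Rightarrow> 'n \<Rightarrow> real) \<Rightarrow> 'n::finite cmat \<Rightarrow> 'n cmat" where
  "hmul s X = (\<chi> i j. s i j *\<^sub>R X $ i $ j)"

lemma hmul_component [simp]: "hmul s X $ i $ j = s i j *\<^sub>R X $ i $ j"
  by (simp add: hmul_def)

lemma hmul_diff: "hmul s (X - Y) = hmul s X - hmul s Y"
  by (simp add: vec_eq_iff algebra_simps)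

lemma hmul_hmul: "hmul s (hmul t X) = hmul (\<lambda>i j. s i j * t i j) X"
  by (simp add: vec_eq_iff)

lemma mstar_hmul: "mstar (hmul s X) = hmul (\<lambda>i j. s j i) (mstar X)"
  by (simp add: vec_eq_iff scaleR_conv_of_real)

text \<open>\<open>ip\<close> pairs entry (i,j) with entry (j,i), so the adjoint multiplier is the
  transposed one.\<close>

lemma ip_hmul_left: "ip (hmul s X) Y = ip X (hmul (\<lambda>i j. s j i) Y)"
  by (simp add: ip_altdef algebra_simps)

definition rcoeff :: "'n::linorder \<Rightarrow> 'n \<Rightarrow> real" where
  "rcoeff i j = (if i < j then 1/2 else if j < i then -1/2 else 0)"

lemma rmat_eq_hmul: "rmat X = hmul rcoeff X"
  by (auto simp: rmat_def rcoeff_def upper_def lower_def vec_eq_iff)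

lemma rcoeff_swap: "rcoeff j i = - rcoeff i j"
  by (auto simp: rcoeff_def)

lemma rcoeff_swap_fun: "(\<lambda>i j. rcoeff j i) = (\<lambda>i j. - rcoeff i j)"
  by (intro ext) (rule rcoeff_swap)

definition Rcoeff :: "'n::finite cmat \<Rightarrow> 'n \<Rightarrow> 'n \<Rightarrow> real" where
  "Rcoeff q i j = (if i = j then 0 else coth (Re (q $ i $ i) - Re (q $ j $ j)))"

lemma Rq_eq_hmul: "Rq q X = hmul (Rcoeff q) X"
  by (auto simp: Rq_def Rcoeff_def vec_eq_iff scaleR_conv_of_real)

lemma Rcoeff_swap: "Rcoeff q j i = - Rcoeff q i j"
proof -
  have "coth (- x) = - coth x" for x
    by (simp add: coth_def)
  from this [of "Re (q $ i $ i) - Re (q $ j $ j)"] show ?thesis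
    by (simp add: Rcoeff_def)
qed

lemma Rcoeff_swap_fun: "(\<lambda>i j. Rcoeff q j i) = (\<lambda>i j. - Rcoeff q i j)"
  by (intro ext) (rule Rcoeff_swap)

lemma dpart_eq_hmul: "dpart X = hmul (\<lambda>i j. of_bool (i = j)) X"
  by (simp add: dpart_def vec_eq_iff)

lemma ip_hmul_antisym: "ip (hmul s X) Y = - ip X (hmul s Y)" if "\<And>i j. s j i = - s i j"
proof -
  have swap: "(\<lambda>i j. s j i) = (\<lambda>i j. - s i j)"
    by (intro ext) (rule that)
  have "hmul (\<lambda>i j. - s i j) Y = - hmul s Y"
    by (simp add: vec_eq_iff)
  then show ?thesis
    unfolding ip_hmul_left swap by (simp add: ip_simps)
qed

lemma ip_rmat_left: "ip (rmat X) Y = - ip X (rmat Y)"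
  unfolding rmat_eq_hmul by (rule ip_hmul_antisym) (rule rcoeff_swap)

lemma ip_Rq_left: "ip (Rq q X) Y = - ip X (Rq q Y)"
  unfolding Rq_eq_hmul by (rule ip_hmul_antisym) (rule Rcoeff_swap)

text \<open>The coefficients of r are real and antisymmetric, so r anticommutes with
  \<open>mstar\<close>.\<close>

lemma pplus_rmat: "pplus (rmat X) = rmat (pminus X)"
  and pminus_rmat: "pminus (rmat X) = rmat (pplus X)"
proof -
  have "mstar (rmat X) = - rmat (mstar X)"
    unfolding rmat_eq_hmul mstar_hmul rcoeff_swap_fun by (simp add: vec_eq_iff)
  then show "pplus (rmat X) = rmat (pminus X)" "pminus (rmat X) = rmat (pplus X)"
    by (simp_all add: pplus_def pminus_def rmat_eq_hmul vec_eq_iff scaleR_add_right scaleR_diff_right)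
qed

lemma mstar_Rq: "mstar (Rq q X) = - Rq q (mstar X)"
  unfolding Rq_eq_hmul mstar_hmul Rcoeff_swap_fun by (simp add: vec_eq_iff)

text \<open>Entrywise multipliers commute, and both are antisymmetric here; moving both across the
  pairing costs two signs, which cancel.\<close>

lemma ip_Rq_rmat_commute: "ip (Rq q X) (rmat Y) = ip (Rq q Y) (rmat X)"
proof -
  have "Rq q (rmat Y) = rmat (Rq q Y)"
    by (simp add: Rq_eq_hmul rmat_eq_hmul hmul_hmul mult.commute)
  then show ?thesis
    by (metis ip_Rq_left ip_rmat_left ip_commute)
qed

lemma ip_dpart_left: "ip (dpart X) Y = ip X (dpart Y)"
  by (auto simp: ip_altdef dpart_def intro!: sum.cong)

lemma ip_diagonal_left: "dpart D = D \<Longrightarrow> ip D X = ip D (dpart X)"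
  by (metis ip_dpart_left)

lemma dpart_rmat: "dpart (rmat X) = 0"
  by (simp add: rmat_eq_hmul dpart_def vec_eq_iff rcoeff_def)

text \<open>With a = q_i - q_j and w the (i,j) entry of the Hermitian matrix
  \<open>hmul e N\<close>, the (i,j) entries of \<open>N\<close> and \<open>mstar N\<close> are
  exp(a) w and exp(-a) w. Their half sum and half difference are cosh(a) w and sinh(a) w, whose
  ratio is the coth in R(q).\<close>

lemma pminus_eq_if_conjugate_hermitian:
  fixes q N :: "'n::{finite,linorder} cmat"
  defines "e \<equiv> (\<lambda>i j. exp (Re (q $ j $ j) - Re (q $ i $ i)))"
  assumes q: "regular q" and herm: "mstar (hmul e N) = hmul e N"
  shows "pminus N = Rq q (pplus N) + dpart N"
proof -
  have "pminus N $ i $ j = (Rq q (pplus N) + dpart N) $ i $ j" for i j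
  proof -
    define a where "a = Re (q $ i $ i) - Re (q $ j $ j)"
    have *: "exp a *\<^sub>R cnj (N $ j $ i) = exp (- a) *\<^sub>R N $ i $ j"
      using arg_cong [OF herm, of "\<lambda>A. A $ i $ j"] by (simp add: e_def a_def scaleR_conv_of_real)
    show ?thesis
    proof (cases "i = j")
      case True
      with * have "cnj (N $ j $ i) = N $ i $ j"
        by (simp add: a_def)
      then show ?thesis
        using True by (simp add: pminus_def Rq_def dpart_def)
    next
      case False
      \<comment> \<open>The diagonal entries of a regular \<open>q\<close> are distinct, which makes
        the division by \<open>sinh a\<close> legitimate.\<close>
      then have "a \<noteq> 0"
        using q unfolding a_def regular_def by (metis less_irrefl neqE right_minus_eq)
      then have "sinh a \<noteq> 0"
        by simp
      define w where "w = exp (- a) *\<^sub>R N $ i $ j"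
      have "N $ i $ j = exp a *\<^sub>R w"
        by (simp add: w_def exp_minus)
      moreover have "cnj (N $ j $ i) = exp (- a) *\<^sub>R w"
        unfolding w_def * [symmetric] by (simp add: exp_minus)
      moreover note w = calculation
      have "N $ i $ j + cnj (N $ j $ i) = (2 * cosh a) *\<^sub>R w"
        "N $ i $ j - cnj (N $ j $ i) = (2 * sinh a) *\<^sub>R w"
        by (simp_all add: w cosh_def sinh_def flip: scaleR_add_left scaleR_diff_left)
      then have "pminus N $ i $ j = cosh a *\<^sub>R w" "pplus N $ i $ j = sinh a *\<^sub>R w"
        by (simp_all add: pminus_def pplus_def)
      then show ?thesis
        using False \<open>sinh a \<noteq> 0\<close> by (simp add: Rq_eq_hmul Rcoeff_def dpart_def coth_def flip: a_def)
    qed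
  qed
  then show ?thesis
    by (simp add: vec_eq_iff)
qed

subsection \<open>The bracket of gradients of invariant functions\<close>

text \<open>The shape forced on \<open>N = \<nabla>\<^sub>1F\<close> by invariance, with \<open>C = [d\<^sub>2F, J]\<close> and \<open>D = \<nabla>\<^sub>1f\<close>.\<close>
definition invariant_gradient :: "'n::finite cmat \<Rightarrow> 'n cmat \<Rightarrow> 'n cmat \<Rightarrow> 'n cmat \<Rightarrow> bool" where
  "invariant_gradient q C N D \<longleftrightarrow>
     pplus N = pplus C \<and> pminus N = Rq q (pplus C) + D \<and> dpart D = D"

lemma ip_invariant_gradient:
  assumes "invariant_gradient q C N D"
  shows "ip N S = ip D (pminus0 S) + ip (Rq q (pplus C)) (pminus S) + ip (pplus C) (pplus S)"
proof -
  have N: "pplus N = pplus C" "pminus N = Rq q (pplus C) + D" "dpart D = D"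
    using assms by (auto simp: invariant_gradient_def)
  show ?thesis
    unfolding ip_pplus_pminus [of N] N(1,2) pminus0_def
    by (simp add: ip_simps ip_diagonal_left [OF N(3), of "pminus S"])
qed

text \<open>The contributions of \<open>DF\<close> and \<open>DH\<close> vanish because r has zero
  diagonal, and those of R(q) are symmetric in \<open>CF\<close> and \<open>CH\<close>. Subtracting
  \<open>CF\<close> removes the pairing of its anti-Hermitian part; what is left on the two sides
  agrees by antisymmetry of r.\<close>

lemma ip_rmat_invariant_gradient:
  assumes "invariant_gradient q CF NF DF" and "invariant_gradient q CH NH DH"
  shows "ip (NF - CF) (rmat CH) = ip NH (rmat CF)"
proof -
  have *: "ip N (rmat X) = ip (Rq q (pplus C)) (rmat (pplus X)) + ip (pplus C) (rmat (pminus X))"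
    if "invariant_gradient q C N D" for C N D X :: "'a cmat"
    using ip_invariant_gradient [OF that, of "rmat X"]
    by (simp add: pminus0_def pplus_rmat pminus_rmat dpart_rmat ip_simps)
  have "ip CF (rmat CH) = ip (pplus CF) (rmat (pminus CH)) + ip (pminus CF) (rmat (pplus CH))"
    using ip_pplus_pminus [of CF "rmat CH"] by (simp add: pplus_rmat pminus_rmat)
  moreover have "ip (pplus CH) (rmat (pminus CF)) = - ip (pminus CF) (rmat (pplus CH))"
    by (metis ip_commute ip_rmat_left)
  ultimately show ?thesis
    using * [OF assms(1), of CH] * [OF assms(2), of CF] ip_Rq_rmat_commute [of q "pplus CF" "pplus CH"]
    by (simp add: ip_diff_left)
qed

lemma reduced_bracket_identity:
  assumes F: "invariant_gradient q (comm dF J) NF DF" and H: "invariant_gradient q (comm dH J) NH DH"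
  shows "2 * (ip (J ** dF - dF ** J + NF) (rplus (dH ** J) - rminus (J ** dH))
        - ip NH (rplus (dF ** J) - rminus (J ** dF)))
     = ip DF (pminus0 (J ** dH + dH ** J)) - ip DH (pminus0 (J ** dF + dF ** J))
     + ip (Rq q (pplus (comm dF J))) (pminus (J ** dH + dH ** J))
     - ip (Rq q (pplus (comm dH J))) (pminus (J ** dF + dF ** J))
     + ip (pminus (J ** dF)) (pminus (dH ** J)) + ip (pplus (dF ** J)) (pplus (J ** dH))
     - ip (pminus (dF ** J)) (pminus (J ** dH)) - ip (pplus (J ** dF)) (pplus (dH ** J))"
proof -
  \<comment> \<open>The halves of the identity in \<open>rplus\<close> and \<open>rminus\<close> add
    up, while the two r parts combine to r of a commutator.\<close>
  have r: "ip A (rplus (d ** J) - rminus (J ** d)) = ip A (rmat (comm d J)) + ip A (J ** d + d ** J) / 2" for A d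
    by (simp add: rplus_def rminus_def comm_def rmat_eq_hmul hmul_diff ip_simps)
  have "J ** dF - dF ** J + NF = NF - comm dF J"
    by (simp add: comm_def)
  with ip_rmat_invariant_gradient [OF F H]
  have "2 * (ip (J ** dF - dF ** J + NF) (rplus (dH ** J) - rminus (J ** dH))
        - ip NH (rplus (dF ** J) - rminus (J ** dF)))
      = ip NF (J ** dH + dH ** J) - ip (comm dF J) (J ** dH + dH ** J) - ip NH (J ** dF + dF ** J)"
    by (simp add: r ip_diff_left [of NF] diff_divide_distrib)
  \<comment> \<open>Cyclicity of the trace lets the two unmixed products in the pairing of
    \<open>comm dF J\<close> with \<open>J ** dH + dH ** J\<close> cancel. This settles all terms
    containing neither R(q) nor \<open>DF\<close>, \<open>DH\<close>.\<close>
  moreover have "ip (J ** dF) (J ** dH) = ip (dF ** J) (dH ** J)"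
    by (simp add: ip_mult_cyclic [of J dF] ip_mult_left [of dF J] matrix_mul_assoc)
  then have "ip (pplus (comm dF J)) (pplus (J ** dH + dH ** J)) - ip (comm dF J) (J ** dH + dH ** J)
      - ip (pplus (comm dH J)) (pplus (J ** dF + dF ** J))
     = ip (pminus (J ** dF)) (pminus (dH ** J)) + ip (pplus (dF ** J)) (pplus (J ** dH))
     - ip (pminus (dF ** J)) (pminus (J ** dH)) - ip (pplus (J ** dF)) (pplus (dH ** J))"
    unfolding ip_pplus_pminus [of "comm dF J"] ip_pplus_pminus [of "J ** dF"] ip_pplus_pminus [of "dF ** J"]
    by (simp add: comm_def pplus_diff pminus_diff pplus_add pminus_add ip_simps
        ip_commute [of "pplus (J ** dH)"] ip_commute [of "pplus (dH ** J)"])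
  ultimately show ?thesis
    unfolding ip_invariant_gradient [OF F] ip_invariant_gradient [OF H] by argo
qed

text \<open>When \<open>dH\<close> commutes with \<open>J\<close>, the r parts cancel outright and
  the second argument collapses to \<open>J ** dH\<close>. This commutes with \<open>J\<close> too,
  so it is orthogonal to \<open>comm dF J\<close>.\<close>

lemma reduced_bracket_identity_commuting:
  assumes F: "invariant_gradient q (comm dF J) NF DF" and comm: "dH ** J = J ** dH"
  shows "ip (J ** dF - dF ** J + NF) (rplus (dH ** J) - rminus (J ** dH))
     = ip DF (pminus0 (J ** dH)) + ip dF (comm (Rq q (pminus (J ** dH)) - pplus (J ** dH)) J)"
proof -
  define C P where "C = comm dF J" and "P = J ** dH"
  have "comm P J = 0"
    unfolding P_def comm_def by (simp add: comm flip: matrix_mul_assoc)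
  then have "ip C P = 0"
    unfolding C_def using ip_comm_right [of dF P J] by (simp add: ip_simps)
  \<comment> \<open>R(q) sends Hermitian matrices to anti-Hermitian ones, so the pairing with it
    detects only the anti-Hermitian part of \<open>C\<close>.\<close>
  have "mstar (Rq q (pminus P)) = - Rq q (pminus P)"
    by (simp add: mstar_Rq mstar_pminus)
  then have "pminus (Rq q (pminus P)) = 0"
    by (simp add: pminus_def)
  then have "ip C (Rq q (pminus P)) = ip (pplus C) (Rq q (pminus P))"
    by (simp add: ip_pplus_pminus [of C] ip_pplus_left [of C "Rq q (pminus P)"] ip_simps)
  also have "\<dots> = - ip (Rq q (pplus C)) (pminus P)"
    by (simp add: ip_Rq_left)
  finally have "ip dF (comm (Rq q (pminus P) - pplus P) J) = ip (Rq q (pplus C)) (pminus P) + ip C (pplus P)"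
    by (simp add: ip_comm_right ip_simps flip: C_def)
  also have "ip C (pplus P) = ip (pplus C) (pplus P)"
    by (metis ip_commute ip_pplus_left)
  moreover have "J ** dF - dF ** J + NF = NF - C" "rplus (dH ** J) - rminus (J ** dH) = P"
    by (simp_all add: comm_def C_def rplus_def rminus_def comm P_def flip: scaleR_add_left)
  ultimately show ?thesis
    using ip_invariant_gradient [OF F, of P] \<open>ip C P = 0\<close>
    by (simp add: ip_simps flip: P_def C_def)
qed

subsection \<open>The matrix exponential\<close>

lemma bounded_bilinear_matrix_mult:
  "bounded_bilinear ((**) :: complex^'n^'n \<Rightarrow> complex^'n^'n \<Rightarrow> complex^'n^'n)"
proof -
  have "bilinear ((**) :: complex^'n^'n \<Rightarrow> complex^'n^'n \<Rightarrow> complex^'n^'n)"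
    unfolding bilinear_def
    by (auto intro!: linearI simp: vec_eq_iff matrix_mult_component sum.distrib scaleR_sum_right algebra_simps)
  then show ?thesis
    by (simp add: bilinear_conv_bounded_bilinear)
qed

lemmas matrix_mult_has_vector_derivative =
  bounded_bilinear.has_vector_derivative [OF bounded_bilinear_matrix_mult]
lemmas scaleR_matrix_mult_left = bounded_bilinear.scaleR_left [OF bounded_bilinear_matrix_mult]
  and scaleR_matrix_mult_right = bounded_bilinear.scaleR_right [OF bounded_bilinear_matrix_mult]

lemma bounded_linear_mstar: "bounded_linear mstar"
  by (auto intro!: linearI simp: mstar_add mstar_scaleR simp flip: linear_conv_bounded_linear)

lemma has_vector_derivative_vec:
  fixes f :: "real \<Rightarrow> ('a::real_normed_vector)^'n"
  assumes "\<And>i. ((\<lambda>t. f t $ i) has_vector_derivative f' $ i) (at t)"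
  shows "(f has_vector_derivative f') (at t)"
  using assms
  by (auto simp: has_vector_derivative_def has_derivative_def bounded_linear_scaleR_left intro!: vec_tendstoI)

lemma mpow_scaleR: "mpow (c *\<^sub>R X) k = c ^ k *\<^sub>R mpow X k"
  by (induction k) (simp_all add: scaleR_matrix_mult_left scaleR_matrix_mult_right mult.commute)

text \<open>The sum of all entry norms dominates every row sum, which gives a geometric bound and
  hence convergence of the exponential series.\<close>

lemma norm_mpow_component_le:
  "norm (mpow X k $ i $ j) \<le> (\<Sum>i\<in>UNIV. \<Sum>j\<in>UNIV. norm (X $ i $ j)) ^ k"
proof (induction k arbitrary: i)
  case 0
  then show ?case by (simp add: mat_def)
next
  case (Suc k)
  let ?K = "\<Sum>i\<in>UNIV. \<Sum>j\<in>UNIV. norm (X $ i $ j)"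
  have "norm (mpow X (Suc k) $ i $ j) \<le> (\<Sum>l\<in>UNIV. norm (X $ i $ l) * norm (mpow X k $ l $ j))"
    by (simp add: matrix_mult_component) (metis (mono_tags, lifting) norm_mult norm_sum sum.cong)
  also have "\<dots> \<le> (\<Sum>l\<in>UNIV. norm (X $ i $ l) * ?K ^ k)"
    by (intro sum_mono mult_left_mono Suc) simp
  also have "\<dots> = (\<Sum>l\<in>UNIV. norm (X $ i $ l)) * ?K ^ k"
    by (simp add: sum_distrib_right)
  also have "\<dots> \<le> ?K * ?K ^ k"
    by (intro mult_right_mono member_le_sum [of i UNIV "\<lambda>i. \<Sum>l\<in>UNIV. norm (X $ i $ l)"])
      (auto intro!: sum_nonneg zero_le_power)
  finally show ?case by simp
qed

text \<open>The complex variable \<open>z\<close> makes each entry an everywhere convergent power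
  series, ready for termwise differentiation.\<close>

lemma summable_mexp_component:
  fixes X :: "'n::finite cmat" and z :: complex
  shows "summable (\<lambda>k. (mpow X k $ i $ j / fact k) * z ^ k)"
proof (rule summable_comparison_test')
  let ?K = "\<Sum>i\<in>UNIV. \<Sum>j\<in>UNIV. norm (X $ i $ j)"
  show "summable (\<lambda>k. (?K * norm z) ^ k /\<^sub>R fact k)"
    by (rule summable_exp_generic)
  show "norm ((mpow X k $ i $ j / fact k) * z ^ k) \<le> (?K * norm z) ^ k /\<^sub>R fact k" if "k \<ge> 0" for k
    using mult_right_mono [OF norm_mpow_component_le [of X k i j], of "norm z ^ k / fact k"]
    by (simp add: norm_mult norm_divide norm_power power_mult_distrib field_simps)
qed

lemma mexp_component: "mexp X $ i $ j = (\<Sum>k. mpow X k $ i $ j / fact k)"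
proof -
  have "(\<lambda>k. mpow X k $ i $ j / fact k) sums (\<Sum>k. mpow X k $ i $ j / fact k)" for i j
    using summable_mexp_component [of X i j 1] by (simp add: summable_sums)
  then have "(\<lambda>k. (1 / fact k) *\<^sub>R mpow X k) sums (\<chi> i j. \<Sum>k. mpow X k $ i $ j / fact k)"
    unfolding sums_def
    by (intro vec_tendstoI) (simp add: scaleR_conv_of_real [where 'a = complex] mult.commute divide_inverse)
  then show ?thesis
    by (simp add: mexp_def sums_iff)
qed

lemma mexp_scaleR_component:
  "mexp (t *\<^sub>R X) $ i $ j = (\<Sum>k. (mpow X k $ i $ j / fact k) * complex_of_real t ^ k)"
  by (simp add: mexp_component mpow_scaleR scaleR_conv_of_real [where 'a = complex] mult.commute)

lemma mexp_zero [simp]: "mexp (0 :: 'n::finite cmat) = mat 1"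
proof -
  have "mexp (0 *\<^sub>R (0 :: 'n cmat)) $ i $ j = mpow 0 0 $ i $ j / fact 0" for i j :: 'n
    unfolding mexp_scaleR_component of_real_0 by (rule powser_zero)
  then show ?thesis
    by (simp add: vec_eq_iff)
qed

lemma mexp_has_vector_derivative:
  "((\<lambda>t. mexp (t *\<^sub>R X)) has_vector_derivative X ** mexp (t *\<^sub>R X)) (at t)"
proof (intro has_vector_derivative_vec)
  fix i j
  define c where "c = (\<lambda>i j k. mpow X k $ i $ j / fact k)"
  have sm: "summable (\<lambda>k. c i j k * z ^ k)" for i j z
    unfolding c_def by (rule summable_mexp_component)
  \<comment> \<open>The factor k + 1 in \<open>diffs\<close> cancels against (k + 1)!, and
    \<open>mpow X (Suc k)\<close> releases one left factor \<open>X\<close>.\<close>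
  have d: "diffs (c i j) k = (\<Sum>l\<in>UNIV. X $ i $ l * c l j k)" for k
    by (simp add: diffs_def c_def matrix_mult_component sum_divide_distrib sum_distrib_left del: of_nat_Suc)
  have "(\<Sum>k. diffs (c i j) k * z ^ k) = (\<Sum>l\<in>UNIV. X $ i $ l * (\<Sum>k. c l j k * z ^ k))" for z
  proof -
    have "(\<Sum>k. diffs (c i j) k * z ^ k) = (\<Sum>k. \<Sum>l\<in>UNIV. X $ i $ l * (c l j k * z ^ k))"
      by (simp add: d sum_distrib_right mult.assoc)
    also have "\<dots> = (\<Sum>l\<in>UNIV. \<Sum>k. X $ i $ l * (c l j k * z ^ k))"
      by (intro suminf_sum summable_mult sm)
    finally show ?thesis
      by (simp add: suminf_mult sm)
  qed
  then have "((\<lambda>z. \<Sum>k. c i j k * z ^ k) has_field_derivative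
      (\<Sum>l\<in>UNIV. X $ i $ l * (\<Sum>k. c l j k * of_real t ^ k))) (at (of_real t))"
    using termdiffs_strong_converges_everywhere [of "c i j" "of_real t", OF sm] by simp
  then have "((\<lambda>t. \<Sum>k. c i j k * of_real t ^ k) has_vector_derivative
      (\<Sum>l\<in>UNIV. X $ i $ l * (\<Sum>k. c l j k * of_real t ^ k))) (at t)"
    by (rule has_vector_derivative_real_field)
  then show "((\<lambda>t. mexp (t *\<^sub>R X) $ i $ j) has_vector_derivative (X ** mexp (t *\<^sub>R X)) $ i $ j) (at t)"
    by (simp add: mexp_scaleR_component matrix_mult_component c_def)
qed

lemma mexp_has_vector_derivative_0:
  "((\<lambda>t. mexp (t *\<^sub>R X)) has_vector_derivative X) (at 0)"
  using mexp_has_vector_derivative [of X 0] by simp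

text \<open>The product \<open>mstar (M t) ** M t\<close> has zero derivative, hence keeps its value
  at t = 0, the identity.\<close>

lemma unitary_mexp:
  assumes "mstar X = - X"
  shows "mexp (t *\<^sub>R X) \<in> unitary"
proof -
  define M where "M t = mexp (t *\<^sub>R X)" for t
  have d: "((\<lambda>t. mstar (M t) ** M t) has_vector_derivative 0) (at t)" for t
  proof -
    have M: "(M has_vector_derivative X ** M t) (at t)"
      unfolding M_def by (rule mexp_has_vector_derivative)
    have "((\<lambda>t. mstar (M t) ** M t) has_vector_derivative
        (mstar (M t) ** (X ** M t) + mstar (X ** M t) ** M t)) (at t)"
      by (intro matrix_mult_has_vector_derivative M
          bounded_linear.has_vector_derivative [OF bounded_linear_mstar])
    moreover have "mstar (X ** M t) ** M t = - (mstar (M t) ** (X ** M t))"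
      by (simp add: mstar_mult assms vec_eq_iff matrix_mult_component sum_negf flip: matrix_mul_assoc)
    ultimately show ?thesis
      by simp
  qed
  have "(\<lambda>t. mstar (M t) ** M t) t = (\<lambda>t. mstar (M t) ** M t) 0"
    by (rule has_vector_derivative_zero_constant [OF convex_UNIV, THEN exE]) (use d in auto)
  then have "mstar (M t) ** M t = mat 1"
    by (simp add: M_def)
  then show ?thesis
    by (simp add: unitary_def matrix_left_right_inverse M_def)
qed

lemma matrix_inv_unitary: "U \<in> unitary \<Longrightarrow> matrix_inv U = mstar U"
  unfolding matrix_inv_def unitary_def
  by (rule some_equality) (auto, metis matrix_mul_assoc matrix_mul_lid matrix_mul_rid)

section \<open>Diagonal matrices and their exponentials\<close>

definition diag :: "('n \<Rightarrow> complex) \<Rightarrow> 'n::finite cmat" where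
  "diag d = (\<chi> i j. if i = j then d i else 0)"

lemma diag_mult_component: "(diag d ** X) $ i $ j = d i * X $ i $ j"
  and mult_diag_component: "(X ** diag d) $ i $ j = X $ i $ j * d j"
  by (simp_all add: diag_def matrix_mult_component if_distrib [of "\<lambda>x. x * _"] if_distrib [of "(*) _"]
      cong: if_cong)

lemma mexp_diag: "mexp (diag d) = diag (\<lambda>i. exp (d i))"
proof -
  have "mpow (diag d) k = diag (\<lambda>i. d i ^ k)" for k
  proof (induction k)
    case 0
    then show ?case by (simp add: diag_def mat_def vec_eq_iff)
  next
    case (Suc k)
    then show ?case by (simp add: vec_eq_iff diag_mult_component) (simp add: diag_def)
  qed
  then show ?thesis
    by (simp add: vec_eq_iff mexp_component exp_def diag_def scaleR_conv_of_real divide_inverse mult.commute)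
qed

lemma diag_mult_diag: "diag d ** diag e = diag (\<lambda>i. d i * e i)"
  by (simp add: vec_eq_iff diag_mult_component) (simp add: diag_def)

lemma diag_one: "diag (\<lambda>_. 1) = mat 1"
  by (simp add: diag_def mat_def)

lemma G0minus_eq_diag: "X = diag (\<lambda>i. of_real (Re (X $ i $ i)))" if "X \<in> G0minus"
proof -
  have "X $ i $ j = diag (\<lambda>i. of_real (Re (X $ i $ i))) $ i $ j" for i j
  proof (cases "i = j")
    case True
    have "cnj (X $ i $ i) = X $ i $ i"
      using that unfolding G0minus_def by (metis (mono_tags, lifting) mem_Collect_eq mstar_component)
    then show ?thesis
      using True by (simp add: diag_def complex_eq_iff)
  next
    case False
    have "X $ i $ j = dpart X $ i $ j"
      using that by (simp add: G0minus_def)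
    then show ?thesis
      using False by (simp add: diag_def dpart_def)
  qed
  then show ?thesis
    unfolding vec_eq_iff by blast
qed

lemma mexp_G0minus:
  assumes "X \<in> G0minus"
  shows "mexp X = diag (\<lambda>i. of_real (exp (Re (X $ i $ i))))"
proof -
  have "mexp X = mexp (diag (\<lambda>i. of_real (Re (X $ i $ i))))"
    using G0minus_eq_diag [OF assms] by (rule arg_cong)
  then show ?thesis
    by (simp add: mexp_diag flip: exp_of_real)
qed

lemma dpart_minus: "dpart (- X) = - dpart X"
  by (simp add: dpart_def vec_eq_iff)

lemma mexp_minus_mult_G0minus:
  assumes "X \<in> G0minus"
  shows "mexp (- X) ** mexp X = mat 1" "mexp X ** mexp (- X) = mat 1"
proof -
  have "- X \<in> G0minus"
    using assms by (simp add: G0minus_def mstar_minus dpart_minus)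
  then show "mexp (- X) ** mexp X = mat 1" "mexp X ** mexp (- X) = mat 1"
    using assms by (simp_all add: mexp_G0minus diag_mult_diag diag_one flip: exp_add of_real_mult)
qed

subsection \<open>Gradients\<close>

lemma grad_in_UNIV_eqI: "grad_in UNIV L = Y" if "\<And>X. ip Y X = L X"
  unfolding grad_in_def by (rule the_equality) (use that in \<open>auto intro!: ip_eqI\<close>)

text \<open>Existence of the gradient: \<open>adjoint L 1\<close> represents \<open>L\<close> for
  the Euclidean inner product, and \<open>mstar\<close> converts it to the trace form.\<close>

lemma ip_grad_in_UNIV:
  assumes "linear L"
  shows "ip (grad_in UNIV L) X = L X"
proof -
  have "ip (mstar (adjoint L 1)) X = L X" for X
    using adjoint_works [OF assms, of X 1] by (simp add: ip_mstar_left inner_commute)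
  then show ?thesis
    by (metis grad_in_UNIV_eqI)
qed

lemma grad_in_G0minus_eqI:
  assumes "Y \<in> G0minus" and Y: "\<And>X. X \<in> G0minus \<Longrightarrow> ip Y X = L X"
  shows "grad_in G0minus L = Y"
  unfolding grad_in_def
proof (rule the_equality)
  fix Z assume Z: "Z \<in> G0minus \<and> (\<forall>X\<in>G0minus. ip Z X = L X)"
  have "dpart (Z - Y) = dpart Z - dpart Y"
    by (simp add: dpart_eq_hmul hmul_diff)
  with Z assms(1) have ZY: "Z - Y \<in> G0minus"
    by (simp add: G0minus_def mstar_diff)
  \<comment> \<open>The difference lies in \<open>G0minus\<close> itself and may test itself; on
    Hermitian matrices the trace form is the Euclidean one, hence definite.\<close>
  then have "ip (Z - Y) (Z - Y) = 0"
    using Z Y by (simp add: ip_diff_left)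
  moreover have "mstar (Z - Y) = Z - Y"
    using ZY by (simp add: G0minus_def)
  ultimately have "(Z - Y) \<bullet> (Z - Y) = 0"
    by (metis ip_mstar_left)
  then show "Z = Y"
    by simp
qed (use assms in auto)

text \<open>Openness upgrades differentiability on the set to differentiability at its
  points.\<close>

lemma open_Mfld: "open (Mfld :: ('n::finite cmat \<times> 'n cmat) set)"
proof -
  have "continuous_on UNIV (\<lambda>p :: 'n cmat \<times> 'n cmat. det (fst p))"
    unfolding det_def by (intro continuous_intros)
  then show ?thesis
    unfolding Mfld_def invertible_det_nz by (intro open_Collect_neq continuous_intros)
qed

lemma invariant_smooth_has_derivative:
  assumes "invariant_smooth F" "invertible g"
  obtains D where "(F has_derivative D) (at (g, J))"
proof -
  have "F differentiable_on Mfld"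
    using assms(1) unfolding invariant_smooth_def by (blast elim: Cinf_on.cases)
  moreover have "(g, J) \<in> Mfld"
    using assms(2) by (simp add: Mfld_def)
  ultimately have "F differentiable (at (g, J))"
    using open_Mfld differentiable_on_eq_differentiable_at by blast
  then show ?thesis
    using that unfolding differentiable_def by blast
qed

lemma has_real_derivative_along_curve:
  assumes "(F has_derivative D) (at (a 0, b 0))"
    and "(a has_vector_derivative a') (at 0)" and "(b has_vector_derivative b') (at 0)"
  shows "((\<lambda>t. F (a t, b t)) has_real_derivative D (a', b')) (at 0)"
proof -
  have "((\<lambda>t. (a t, b t)) has_vector_derivative (a', b')) (at 0)"
    using assms(2,3) by (rule has_vector_derivative_Pair)
  then have "((\<lambda>t. F (a t, b t)) has_derivative (\<lambda>t. D (t *\<^sub>R (a', b')))) (at 0)"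
    unfolding has_vector_derivative_def by (rule has_derivative_compose) (use assms(1) in simp)
  moreover have "D (t *\<^sub>R (a', b')) = D (a', b') * t" for t
    using has_derivative_linear [OF assms(1)] by (metis linear_scale mult.commute real_scaleR_def)
  ultimately show ?thesis
    by (simp add: has_field_derivative_def)
qed

lemmas matrix_mult_left_has_vector_derivative = bounded_linear.has_vector_derivative
    [OF bounded_bilinear.bounded_linear_left [OF bounded_bilinear_matrix_mult]]
  and matrix_mult_right_has_vector_derivative = bounded_linear.has_vector_derivative
    [OF bounded_bilinear.bounded_linear_right [OF bounded_bilinear_matrix_mult]]

section \<open>Gradients on the full space and infinitesimal invariance\<close>

context
  fixes F :: "'n::finite cmat \<times> 'n cmat \<Rightarrow> real" and g J :: "'n cmat" and D
  assumes D: "(F has_derivative D) (at (g, J))"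
begin

lemma deriv_mexp_mult: "deriv (\<lambda>t. F (mexp (t *\<^sub>R X) ** g, J)) 0 = D (X ** g, 0)"
  by (intro DERIV_imp_deriv has_real_derivative_along_curve matrix_mult_left_has_vector_derivative
      mexp_has_vector_derivative_0 has_vector_derivative_const) (simp add: D)

lemma deriv_mult_mexp: "deriv (\<lambda>t. F (g ** mexp (t *\<^sub>R X), J)) 0 = D (g ** X, 0)"
  by (intro DERIV_imp_deriv has_real_derivative_along_curve matrix_mult_right_has_vector_derivative
      mexp_has_vector_derivative_0 has_vector_derivative_const) (simp add: D)

lemma deriv_add_scaleR: "deriv (\<lambda>t. F (g, J + t *\<^sub>R X)) 0 = D (0, X)"
proof -
  have "((\<lambda>t. J + t *\<^sub>R X) has_vector_derivative X) (at 0)"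
    by (auto intro!: derivative_eq_intros)
  then show ?thesis
    by (intro DERIV_imp_deriv has_real_derivative_along_curve has_vector_derivative_const) (simp_all add: D)
qed

lemma ip_nabla1: "ip (nabla1 F g J) X = D (X ** g, 0)"
  and ip_nabla1': "ip (nabla1' F g J) X = D (g ** X, 0)"
  and ip_d2: "ip (d2 F g J) X = D (0, X)"
proof -
  note lin = linear_compose [OF _ has_derivative_linear [OF D], unfolded o_def]
  have "linear (\<lambda>X :: 'n cmat. (X ** g, 0 :: 'n cmat))"
    "linear (\<lambda>X :: 'n cmat. (g ** X, 0 :: 'n cmat))"
    "linear (\<lambda>X. (0 :: 'n cmat, X :: 'n cmat))"
    by (auto intro!: linearI simp: matrix_add_ldistrib bounded_bilinear.add_left [OF bounded_bilinear_matrix_mult]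
        scaleR_matrix_mult_left scaleR_matrix_mult_right)
  from this [THEN lin] show "ip (nabla1 F g J) X = D (X ** g, 0)"
    "ip (nabla1' F g J) X = D (g ** X, 0)" "ip (d2 F g J) X = D (0, X)"
    unfolding nabla1_def nabla1'_def d2_def deriv_mexp_mult deriv_mult_mexp deriv_add_scaleR
    by (simp_all add: ip_grad_in_UNIV)
qed

text \<open>The right translation direction \<open>g ** X\<close> equals
  \<open>(g ** X ** g') ** g\<close>, a left translation direction; cyclicity moves the conjugation
  onto the gradient.\<close>

lemma nabla1'_eq_conjugate:
  assumes "g' ** g = mat 1"
  shows "nabla1' F g J = g' ** nabla1 F g J ** g"
proof (rule ip_eqI)
  fix X
  have "ip (nabla1' F g J) X = D ((g ** X ** g') ** g, 0)"
    by (simp add: ip_nabla1' assms flip: matrix_mul_assoc)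
  also have "\<dots> = ip (nabla1 F g J) (g ** X ** g')"
    by (simp add: ip_nabla1)
  also have "\<dots> = ip (g' ** nabla1 F g J ** g) X"
    by (simp add: ip_mult_left [of "nabla1 F g J"] ip_mult_cyclic [of g'] flip: matrix_mul_assoc)
  finally show "ip (nabla1' F g J) X = ip (g' ** nabla1 F g J ** g) X" .
qed

lemma mstar_nabla1'_invariant:
  assumes F: "invariant_smooth F" and g: "invertible g"
  shows "mstar (nabla1' F g J) = nabla1' F g J"
proof -
  have "ip (nabla1' F g J) X = 0" if X: "mstar X = - X" for X
  proof -
    \<comment> \<open>The action multiplies by the inverse of the unitary matrix, which is its
      adjoint, so the tangent direction below is \<open>mstar X\<close>, that is,
      \<open>- X\<close>.\<close>
    have inv: "(\<lambda>t. F (g ** mstar (mexp (t *\<^sub>R X)), J)) = (\<lambda>t. F (g, J))"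
      using F g unitary_mexp [OF X] unfolding invariant_smooth_def by (metis matrix_inv_unitary)
    have "((\<lambda>t. F (g ** mstar (mexp (t *\<^sub>R X)), J)) has_real_derivative D (g ** mstar X, 0)) (at 0)"
      by (intro has_real_derivative_along_curve matrix_mult_right_has_vector_derivative
          bounded_linear.has_vector_derivative [OF bounded_linear_mstar]
          mexp_has_vector_derivative_0 has_vector_derivative_const) (simp add: D)
    then have "D (g ** mstar X, 0) = 0"
      unfolding inv by (rule DERIV_unique) simp
    then show ?thesis
      by (simp add: X ip_simps flip: ip_nabla1')
  qed
  then have "pplus (nabla1' F g J) = pplus 0"
    by (intro pplus_eqI) (simp add: ip_simps)
  moreover have "mstar 0 = (0 :: 'n cmat)"
    by (simp add: vec_eq_iff)
  ultimately show ?thesis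
    by (metis pplus_eq_0_iff)
qed

text \<open>Along the left U(n) orbit \<open>g\<close> moves in direction \<open>X ** g\<close> and
  \<open>J\<close> in direction \<open>comm X J\<close>. Constancy of \<open>F\<close> makes the two
  derivatives cancel, and cyclicity turns the second into minus a pairing with
  \<open>comm (d2 F g J) J\<close>.\<close>

lemma pplus_nabla1_invariant:
  assumes F: "invariant_smooth F" and g: "invertible g"
  shows "pplus (nabla1 F g J) = pplus (comm (d2 F g J) J)"
proof (rule pplus_eqI)
  fix X :: "'n cmat"
  assume X: "mstar X = - X"
  define M where "M t = mexp (t *\<^sub>R X)" for t
  have inv: "(\<lambda>t. F (M t ** g, M t ** J ** mstar (M t))) = (\<lambda>t. F (g, J))"
  proof
    fix t
    have "M t \<in> unitary"
      unfolding M_def using X by (rule unitary_mexp)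
    with F g have "F (M t ** g, M t ** J ** matrix_inv (M t)) = F (g, J)"
      unfolding invariant_smooth_def by blast
    then show "F (M t ** g, M t ** J ** mstar (M t)) = F (g, J)"
      by (simp add: matrix_inv_unitary \<open>M t \<in> unitary\<close>)
  qed
  have M: "(M has_vector_derivative X) (at 0)" and M0: "M 0 = mat 1"
    unfolding M_def by (rule mexp_has_vector_derivative_0) simp
  have "((\<lambda>t. M t ** J ** mstar (M t)) has_vector_derivative
      M 0 ** J ** mstar X + (X ** J) ** mstar (M 0)) (at 0)"
    by (intro matrix_mult_has_vector_derivative matrix_mult_left_has_vector_derivative
        bounded_linear.has_vector_derivative [OF bounded_linear_mstar] M)
  moreover have "M 0 ** J ** mstar X + (X ** J) ** mstar (M 0) = comm X J"
    by (simp add: M0 X comm_def bounded_bilinear.minus_right [OF bounded_bilinear_matrix_mult])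
  ultimately have "((\<lambda>t. F (M t ** g, M t ** J ** mstar (M t))) has_real_derivative D (X ** g, comm X J)) (at 0)"
    by (intro has_real_derivative_along_curve matrix_mult_left_has_vector_derivative M) (simp_all add: D M0)
  then have "D (X ** g, comm X J) = 0"
    unfolding inv by (rule DERIV_unique) simp
  moreover have "D (X ** g, comm X J) = D (X ** g, 0) + D (0, comm X J)"
    using linear_add [OF has_derivative_linear [OF D], of "(X ** g, 0)" "(0, comm X J)"] by simp
  ultimately have "ip (nabla1 F g J) X + ip (d2 F g J) (comm X J) = 0"
    by (simp add: ip_nabla1 ip_d2)
  then show "ip (nabla1 F g J) X = ip (comm (d2 F g J) J) X"
    by (simp add: ip_comm_right)
qed

end

section \<open>Restriction to the regular diagonal slice\<close>

lemma regular_imp_G0minus: "regular q \<Longrightarrow> q \<in> G0minus"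
  by (simp add: regular_def)

lemma invertible_mexp_G0minus: "X \<in> G0minus \<Longrightarrow> invertible (mexp X)"
  unfolding invertible_def using mexp_minus_mult_G0minus by blast

lemma G0minus_add_scaleR: "X + t *\<^sub>R Y \<in> G0minus" if "X \<in> G0minus" "Y \<in> G0minus"
proof -
  have "dpart (X + t *\<^sub>R Y) = dpart X + t *\<^sub>R dpart Y"
    by (simp add: dpart_def vec_eq_iff)
  with that show ?thesis
    by (simp add: G0minus_def mstar_add mstar_scaleR)
qed

lemma mexp_add_G0minus: "mexp (X + Y) = mexp Y ** mexp X" if "X \<in> G0minus" "Y \<in> G0minus"
  using that G0minus_add_scaleR [OF that, of 1]
  by (simp add: mexp_G0minus diag_mult_diag exp_add mult.commute)

lemma eventually_regular:
  fixes q X :: "'n::{finite,linorder} cmat"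
  assumes "regular q" "X \<in> G0minus"
  shows "\<forall>\<^sub>F t in nhds 0. regular (q + t *\<^sub>R X)"
proof -
  have "\<forall>\<^sub>F t in nhds 0. i < j \<longrightarrow> Re ((q + t *\<^sub>R X) $ j $ j) < Re ((q + t *\<^sub>R X) $ i $ i)" for i j
  proof (cases "i < j")
    case True
    define f where "f t = Re ((q + t *\<^sub>R X) $ i $ i) - Re ((q + t *\<^sub>R X) $ j $ j)" for t
    have "continuous_on UNIV f"
      unfolding f_def by (simp) (intro continuous_intros)
    then have "(f \<longlongrightarrow> f 0) (nhds 0)"
      by (simp add: continuous_on_eq_continuous_at isCont_def tendsto_at_iff_tendsto_nhds)
    moreover have "f 0 > 0"
      using True assms(1) by (simp add: f_def regular_def)
    ultimately have "\<forall>\<^sub>F t in nhds 0. f t > 0"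
      by (rule order_tendstoD)
    then show ?thesis
      by eventually_elim (simp add: f_def)
  qed simp
  then have "\<forall>\<^sub>F t in nhds 0. \<forall>i j. i < j \<longrightarrow> Re ((q + t *\<^sub>R X) $ j $ j) < Re ((q + t *\<^sub>R X) $ i $ i)"
    by (intro eventually_all_finite)
  then show ?thesis
    by eventually_elim (use assms in \<open>simp only: regular_def G0minus_add_scaleR; simp\<close>)
qed

lemma red_d2_restrict: "regular q \<Longrightarrow> red_d2 (restrict F M0reg) q J = d2 F (mexp q) J"
proof -
  assume "regular q"
  then have "(mexp q, K) \<in> M0reg" for K
    by (auto simp: M0reg_def)
  then show ?thesis
    by (simp add: red_d2_def d2_def)
qed

lemma conjugate_mexp_eq_hmul:
  assumes "q \<in> G0minus"
  shows "mexp (- q) ** N ** mexp q = hmul (\<lambda>i j. exp (Re (q $ j $ j) - Re (q $ i $ i))) N"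
proof -
  have "- q \<in> G0minus"
    using assms by (simp add: G0minus_def mstar_minus dpart_minus)
  then show ?thesis
    using assms by (simp add: mexp_G0minus vec_eq_iff mult_diag_component diag_mult_component)
      (simp add: scaleR_conv_of_real exp_diff exp_minus field_simps)
qed

lemma dpart_hermitian_conjugate:
  assumes "mstar (hmul (\<lambda>i j. exp (e j - e i)) N) = hmul (\<lambda>i j. exp (e j - e i)) N"
  shows "dpart N \<in> G0minus"
proof -
  have "cnj (N $ i $ i) = N $ i $ i" for i
    using arg_cong [OF assms, of "\<lambda>A. A $ i $ i"] by simp
  then show ?thesis
    by (auto simp: G0minus_def dpart_def vec_eq_iff)
qed

text \<open>Conjugation by a diagonal matrix commutes with r, and its coefficients at (i,j) and
  (j,i) are mutually inverse, so it preserves the pairing.\<close>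

lemma ip_rmat_conjugate:
  "ip (rmat (hmul (\<lambda>i j. exp (e j - e i)) M)) (hmul (\<lambda>i j. exp (e j - e i)) N) = ip (rmat M) N"
proof -
  define c where "c = (\<lambda>i j. exp (e j - e i))"
  have "ip (rmat (hmul c M)) (hmul c N) = ip (hmul c (rmat M)) (hmul c N)"
    by (simp add: rmat_eq_hmul hmul_hmul mult.commute)
  also have "\<dots> = ip (rmat M) (hmul (\<lambda>i j. c j i * c i j) N)"
    by (simp add: ip_hmul_left hmul_hmul)
  also have "hmul (\<lambda>i j. c j i * c i j) N = N"
    by (simp add: c_def vec_eq_iff flip: exp_add)
  finally show ?thesis
    by (simp add: c_def)
qed

lemma
  fixes F :: "'n::{finite,linorder} cmat \<times> 'n cmat \<Rightarrow> real"
  assumes F: "invariant_smooth F" and q: "regular q"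
  shows nabla1'_mexp_regular: "nabla1' F (mexp q) J
      = hmul (\<lambda>i j. exp (Re (q $ j $ j) - Re (q $ i $ i))) (nabla1 F (mexp q) J)"
    and invariant_gradient_regular: "invariant_gradient q (comm (d2 F (mexp q) J) J)
      (nabla1 F (mexp q) J) (red_nabla1 (restrict F M0reg) q J)"
proof -
  note qG = regular_imp_G0minus [OF q]
  note inv = invertible_mexp_G0minus [OF qG]
  obtain D where D: "(F has_derivative D) (at (mexp q, J))"
    using invariant_smooth_has_derivative [OF F inv] by blast
  define N where "N = nabla1 F (mexp q) J"
  show eq: "nabla1' F (mexp q) J = hmul (\<lambda>i j. exp (Re (q $ j $ j) - Re (q $ i $ i))) (nabla1 F (mexp q) J)"
    using nabla1'_eq_conjugate [OF D] mexp_minus_mult_G0minus [OF qG] conjugate_mexp_eq_hmul [OF qG] by metis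
  have herm: "mstar (hmul (\<lambda>i j. exp (Re (q $ j $ j) - Re (q $ i $ i))) N)
      = hmul (\<lambda>i j. exp (Re (q $ j $ j) - Re (q $ i $ i))) N"
    using mstar_nabla1'_invariant [OF D F inv] unfolding eq N_def .
  \<comment> \<open>The reduced derivative supplies exactly the diagonal term left over in
    \<open>pminus_eq_if_conjugate_hermitian\<close>.\<close>
  have red: "red_nabla1 (restrict F M0reg) q J = dpart N"
    unfolding red_nabla1_def
  proof (rule grad_in_G0minus_eqI)
    show "dpart N \<in> G0minus"
      using herm by (rule dpart_hermitian_conjugate)
    fix X :: "'n cmat"
    assume X: "X \<in> G0minus"
    have "0 \<in> (G0minus :: 'n cmat set)"
      by (simp add: G0minus_def mstar_def dpart_def vec_eq_iff)
    then have tX: "t *\<^sub>R X \<in> G0minus" for t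
      using G0minus_add_scaleR [of 0 X t] X by simp
    \<comment> \<open>Outside \<open>M0reg\<close> the restriction is \<open>undefined\<close>;
      regularity is an open condition, so for small t the curve stays inside and the derivative at 0
      is that of \<open>F\<close>.\<close>
    have "\<forall>\<^sub>F t in nhds 0. restrict F M0reg (mexp (q + t *\<^sub>R X), J) = F (mexp (t *\<^sub>R X) ** mexp q, J)"
      using eventually_regular [OF q X]
    proof eventually_elim
      case (elim t)
      then have "(mexp (q + t *\<^sub>R X), J) \<in> M0reg"
        by (auto simp: M0reg_def)
      then show ?case
        by (simp add: mexp_add_G0minus qG tX)
    qed
    then have "deriv (\<lambda>t. restrict F M0reg (mexp (q + t *\<^sub>R X), J)) 0
        = deriv (\<lambda>t. F (mexp (t *\<^sub>R X) ** mexp q, J)) 0"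
      by (rule deriv_cong_ev) simp
    also have "\<dots> = ip N X"
      unfolding N_def deriv_mexp_mult [OF D] ip_nabla1 [OF D] ..
    also have "\<dots> = ip (dpart N) X"
      using X by (simp add: G0minus_def ip_dpart_left)
    finally show "ip (dpart N) X = deriv (\<lambda>t. restrict F M0reg (mexp (q + t *\<^sub>R X), J)) 0" ..
  qed
  have "dpart (dpart N) = dpart N"
    by (simp add: dpart_def vec_eq_iff)
  then show "invariant_gradient q (comm (d2 F (mexp q) J) J)
      (nabla1 F (mexp q) J) (red_nabla1 (restrict F M0reg) q J)"
    unfolding invariant_gradient_def red
    using pplus_nabla1_invariant [OF D F inv] pminus_eq_if_conjugate_hermitian [OF q herm]
    by (simp add: N_def)
qed

subsection \<open>Traces of powers\<close>

lemma mpow_commute: "A ** J = J ** A \<Longrightarrow> A ** mpow J k = mpow J k ** A"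
  by (induction k) (simp_all, metis matrix_mul_assoc)

text \<open>The trace collapses the derivative by cyclicity; allowing a factor \<open>A\<close> that commutes with \<open>J\<close>
  makes the induction on \<open>k\<close> work.\<close>
lemma mpow_has_vector_derivative:
  obtains D where "((\<lambda>t. mpow (J + t *\<^sub>R X) k) has_vector_derivative D) (at 0)"
    and "\<And>A. A ** J = J ** A \<Longrightarrow> trace (A ** D) = of_nat k * trace (A ** mpow J (k - 1) ** X)"
proof (induction k arbitrary: thesis)
  case 0
  show ?case
    by (rule 0 [of 0]) (simp_all add: trace_def)
next
  case (Suc k)
  obtain D where D: "((\<lambda>t. mpow (J + t *\<^sub>R X) k) has_vector_derivative D) (at 0)"
    and tr: "\<And>A. A ** J = J ** A \<Longrightarrow> trace (A ** D) = of_nat k * trace (A ** mpow J (k - 1) ** X)"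
    using Suc.IH by blast
  have "((\<lambda>t. J + t *\<^sub>R X) has_vector_derivative X) (at 0)"
    by (auto intro!: derivative_eq_intros)
  from matrix_mult_has_vector_derivative [OF this D]
  have "((\<lambda>t. mpow (J + t *\<^sub>R X) (Suc k)) has_vector_derivative J ** D + X ** mpow J k) (at 0)"
    by simp
  moreover have "trace (A ** (J ** D + X ** mpow J k)) = of_nat (Suc k) * trace (A ** mpow J (Suc k - 1) ** X)"
    if A: "A ** J = J ** A" for A
  proof -
    have "trace (A ** (X ** mpow J k)) = trace (mpow J k ** (A ** X))"
      by (metis matrix_mul_assoc trace_mul_sym)
    also have "\<dots> = trace (A ** mpow J k ** X)"
      by (simp add: mpow_commute [OF A] matrix_mul_assoc)
    finally have 1: "trace (A ** (X ** mpow J k)) = trace (A ** mpow J k ** X)" .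
    have "(A ** J) ** J = J ** (A ** J)"
      using A by (metis matrix_mul_assoc)
    \<comment> \<open>The induction hypothesis is applied to \<open>A ** J\<close>, which again
      commutes with \<open>J\<close>.\<close>
    then have "trace (A ** (J ** D)) = of_nat k * trace (A ** (J ** mpow J (k - 1)) ** X)"
      using tr [of "A ** J"] by (simp add: matrix_mul_assoc)
    \<comment> \<open>For k = 0 the truncated exponent \<open>k - 1\<close> is harmless because the
      factor k is zero.\<close>
    also have "\<dots> = of_nat k * trace (A ** mpow J k ** X)"
      by (cases k) simp_all
    finally show ?thesis
      using 1 by (simp add: matrix_add_ldistrib trace_add algebra_simps)
  qed
  ultimately show ?case
    by (rule Suc.prems)
qed

text \<open>The constant diagonal matrix encodes multiplication by the complex scalar
  \<open>c\<close>.\<close>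

lemma scalar_diag_commute: "diag (\<lambda>_. c) ** A = A ** diag (\<lambda>_. c)" for A :: "'n::finite cmat"
  by (simp add: vec_eq_iff diag_mult_component mult_diag_component)

lemma trace_scalar_diag_mult: "trace (diag (\<lambda>_. c) ** A) = c * trace A"
  by (simp add: trace_def diag_mult_component sum_distrib_left)

text \<open>A common form for both Hamiltonian families: \<open>c = 1\<close> gives the real part of
  the trace and \<open>c = - \<i>\<close> the imaginary part.\<close>

definition trace_power :: "complex \<Rightarrow> nat \<Rightarrow> 'n::finite cmat \<times> 'n cmat \<Rightarrow> real" where
  "trace_power c k p = Re (c * trace (mpow (snd p) k)) / real k"

lemma Hk_eq_trace_power: "Hk k = trace_power 1 k"
  and Hk_tilde_eq_trace_power: "Hk_tilde k = trace_power (- \<i>) k"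
  by (simp_all add: fun_eq_iff Hk_def Hk_tilde_def trace_power_def)

lemma nabla1_trace_power: "nabla1 (trace_power c k) g J = 0"
  and nabla1'_trace_power: "nabla1' (trace_power c k) g J = 0"
  unfolding nabla1_def nabla1'_def
  by (intro grad_in_UNIV_eqI; simp add: trace_power_def ip_simps)+

lemma bounded_linear_trace: "bounded_linear (trace :: 'n::finite cmat \<Rightarrow> complex)"
  by (auto intro!: linearI simp: trace_def sum.distrib scaleR_sum_right simp flip: linear_conv_bounded_linear)

lemma d2_trace_power:
  assumes "k \<ge> 1"
  shows "d2 (trace_power c k) g J = diag (\<lambda>_. c) ** mpow J (k - 1)"
  unfolding d2_def
proof (rule grad_in_UNIV_eqI)
  fix X
  obtain D where D: "((\<lambda>t. mpow (J + t *\<^sub>R X) k) has_vector_derivative D) (at 0)"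
    and tr: "\<And>A. A ** J = J ** A \<Longrightarrow> trace (A ** D) = of_nat k * trace (A ** mpow J (k - 1) ** X)"
    using mpow_has_vector_derivative by blast
  have "((\<lambda>t. Re (c * trace (mpow (J + t *\<^sub>R X) k))) has_vector_derivative Re (c * trace D)) (at 0)"
    by (intro bounded_linear.has_vector_derivative [OF bounded_linear_Re]
        bounded_linear.has_vector_derivative [OF bounded_linear_mult_right]
        bounded_linear.has_vector_derivative [OF bounded_linear_trace] D)
  then have "((\<lambda>t. trace_power c k (g, J + t *\<^sub>R X)) has_real_derivative Re (c * trace D) / real k) (at 0)"
    by (auto simp: trace_power_def has_real_derivative_iff_has_vector_derivative [symmetric] intro!: DERIV_cdivide)
  then have "deriv (\<lambda>t. trace_power c k (g, J + t *\<^sub>R X)) 0 = Re (c * trace D) / real k"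
    by (rule DERIV_imp_deriv)
  also have "c * trace D = of_nat k * trace (diag (\<lambda>_. c) ** mpow J (k - 1) ** X)"
    using tr [OF scalar_diag_commute, of c] by (simp add: trace_scalar_diag_mult)
  also have "Re \<dots> / real k = ip (diag (\<lambda>_. c) ** mpow J (k - 1)) X"
    using assms by (simp add: ip_def)
  finally show "ip (diag (\<lambda>_. c) ** mpow J (k - 1)) X = deriv (\<lambda>t. trace_power c k (g, J + t *\<^sub>R X)) 0" ..
qed

lemma d2_trace_power_commute:
  assumes "k \<ge> 1"
  shows "d2 (trace_power c k) g J ** J = J ** d2 (trace_power c k) g J"
proof -
  have "mpow J (k - 1) ** J = J ** mpow J (k - 1)"
    by (simp add: mpow_commute)
  then show ?thesis
    unfolding d2_trace_power [OF assms] by (metis matrix_mul_assoc scalar_diag_commute)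
qed

section \<open>Assembly of the two bracket formulas\<close>

theorem theorem3p5:
  fixes F H :: "'n::{finite,linorder} cmat \<times> 'n cmat \<Rightarrow> real"
    and q J :: "'n cmat"
  assumes F: "invariant_smooth F" and H: "invariant_smooth H"
    and q: "regular q"
  shows
   "(let f = restrict F M0reg; h = restrict H M0reg in
     2 * bracket2 F H (mexp q) J =
       ip (red_nabla1 f q J) (pminus0 (red_nabla2 h q J + red_nabla2' h q J))
     - ip (red_nabla1 h q J) (pminus0 (red_nabla2 f q J + red_nabla2' f q J))
     + ip (Rq q (pplus (comm (red_d2 f q J) J))) (pminus (red_nabla2 h q J + red_nabla2' h q J))
     - ip (Rq q (pplus (comm (red_d2 h q J) J))) (pminus (red_nabla2 f q J + red_nabla2' f q J))
     + ip (pminus (red_nabla2 f q J)) (pminus (red_nabla2' h q J))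
     + ip (pplus (red_nabla2' f q J)) (pplus (red_nabla2 h q J))
     - ip (pminus (red_nabla2' f q J)) (pminus (red_nabla2 h q J))
     - ip (pplus (red_nabla2 f q J)) (pplus (red_nabla2' h q J)))
   \<and> (\<forall>k\<ge>1. \<forall>H'\<in>{Hk k, Hk_tilde k}.
       (let f = restrict F M0reg; h = restrict H' M0reg in
        bracket2 F H' (mexp q) J =
          ip (red_nabla1 f q J) (pminus0 (red_nabla2 h q J))
        + ip (red_d2 f q J) (comm (Rq q (pminus (red_nabla2 h q J)) - pplus (red_nabla2 h q J)) J)))"
proof (intro conjI allI impI ballI)
  note restrict_simps = red_nabla2_def red_nabla2'_def red_d2_restrict [OF q]
  note grad_F = invariant_gradient_regular [OF F q, of J]
  \<comment> \<open>The right gradients are the left ones conjugated by the same diagonal matrix, so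
    the first two bracket terms cancel.\<close>
  have "ip (rmat (nabla1' F (mexp q) J)) (nabla1' H (mexp q) J) = ip (rmat (nabla1 F (mexp q) J)) (nabla1 H (mexp q) J)"
    by (simp add: nabla1'_mexp_regular F H q ip_rmat_conjugate)
  then have "bracket2 F H (mexp q) J
    = ip (nabla2 F (mexp q) J - nabla2' F (mexp q) J + nabla1 F (mexp q) J)
         (rplus (nabla2' H (mexp q) J) - rminus (nabla2 H (mexp q) J))
      - ip (nabla1 H (mexp q) J) (rplus (nabla2' F (mexp q) J) - rminus (nabla2 F (mexp q) J))"
    unfolding bracket2_def by (simp add: ip_add_left)
  then show "let f = restrict F M0reg; h = restrict H M0reg in
     2 * bracket2 F H (mexp q) J =
       ip (red_nabla1 f q J) (pminus0 (red_nabla2 h q J + red_nabla2' h q J))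
     - ip (red_nabla1 h q J) (pminus0 (red_nabla2 f q J + red_nabla2' f q J))
     + ip (Rq q (pplus (comm (red_d2 f q J) J))) (pminus (red_nabla2 h q J + red_nabla2' h q J))
     - ip (Rq q (pplus (comm (red_d2 h q J) J))) (pminus (red_nabla2 f q J + red_nabla2' f q J))
     + ip (pminus (red_nabla2 f q J)) (pminus (red_nabla2' h q J))
     + ip (pplus (red_nabla2' f q J)) (pplus (red_nabla2 h q J))
     - ip (pminus (red_nabla2' f q J)) (pminus (red_nabla2 h q J))
     - ip (pplus (red_nabla2 f q J)) (pplus (red_nabla2' h q J))"
    unfolding Let_def restrict_simps nabla2_def nabla2'_def
    using reduced_bracket_identity [OF grad_F invariant_gradient_regular [OF H q]] by simp
  fix k :: nat and H'
  assume k: "1 \<le> k" and "H' \<in> {Hk k, Hk_tilde k :: 'n cmat \<times> 'n cmat \<Rightarrow> real}"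
  then obtain c where H': "H' = trace_power c k"
    by (auto simp: Hk_eq_trace_power Hk_tilde_eq_trace_power)
  \<comment> \<open>\<open>H'\<close> depends on \<open>J\<close> alone, so both of its group
    gradients vanish, and with them three of the five bracket terms.\<close>
  have "bracket2 F H' (mexp q) J
    = ip (nabla2 F (mexp q) J - nabla2' F (mexp q) J + nabla1 F (mexp q) J)
         (rplus (nabla2' H' (mexp q) J) - rminus (nabla2 H' (mexp q) J))"
    unfolding bracket2_def H' nabla1_trace_power nabla1'_trace_power ip_zero_left ip_zero_right
    by (simp add: ip_add_left)
  then show "let f = restrict F M0reg; h = restrict H' M0reg in
        bracket2 F H' (mexp q) J =
          ip (red_nabla1 f q J) (pminus0 (red_nabla2 h q J))
        + ip (red_d2 f q J) (comm (Rq q (pminus (red_nabla2 h q J)) - pplus (red_nabla2 h q J)) J)"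
    unfolding Let_def restrict_simps nabla2_def nabla2'_def
    using reduced_bracket_identity_commuting [OF grad_F d2_trace_power_commute [OF k]] H' by simp
qed

end
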